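(* If $G$ is a graph with minimum degree $\delta$ and maximum degree $\Delta$, and $\alpha>0$, then $$2\delta^{2\alpha}M_2^{-\alpha}(G)\le SDD_{\alpha}(G)\le 2\Delta^{2\alpha}M_2^{-\alpha}(G),$$ $$\Delta^{-2\alpha}M_1^{2\alpha+1}(G)\le SDD_{\alpha}(G)\le \delta^{-2\alpha}M_1^{2\alpha+1}(G),$$ and the equality in each bound is attained if and only if $G$ is regular.
   Context: For a graph $G$ with vertex set $V(G)$ and edge set $E(G)$, $d_u$ denotes the degree of the vertex $u$, and $uv$ denotes the edge of $G$ connecting the vertices $u$ and $v$. For $\alpha\in\mathbb{R}$, the variable symmetric division deg index is $$SDD_\alpha(G)=\sum_{uv\in E(G)}\left(\frac{d_u^\alpha}{d_v^\alpha}+\frac{d_v^\alpha}{d_u^\alpha}\right).$$ For $a\in\mathbb{R}$, the first and second variable Zagreb indices (here the superscript $a$ on $M_1$ and $M_2$ is a parameter, not a power) are $$M_1^{a}(G)=\sum_{u\in V(G)}d_u^{a},\qquad M_2^{a}(G)=\sum_{uv\in E(G)}(d_ud_v)^{a}.$$ A graph is regular if all its vertices have the same degree.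
   Formalization: The graph is assumed to have minimum degree δ > 0 (no isolated vertices): for δ = 0 the term δ^{-2α} is undefined, and K_2 plus an isolated vertex attains the first upper bound without being regular. *)

theory Defs
  imports Complex_Main
begin

text \<open>A (non-null) finite simple graph is given by its vertex set and its set of edges, an edge
  being a set of two distinct vertices.\<close>

definition simple_graph :: "'a set \<Rightarrow> 'a set set \<Rightarrow> bool" where
  "simple_graph V E \<longleftrightarrow>
     finite V \<and> V \<noteq> {} \<and> (\<forall>e\<in>E. \<exists>u\<in>V. \<exists>v\<in>V. u \<noteq> v \<and> e = {u, v})"

definition degree :: "'a set set \<Rightarrow> 'a \<Rightarrow> nat" where
  "degree E u = card {e \<in> E. u \<in> e}"

definition min_degree :: "'a set \<Rightarrow> 'a set set \<Rightarrow> nat" where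
  "min_degree V E = Min (degree E ` V)"

definition max_degree :: "'a set \<Rightarrow> 'a set set \<Rightarrow> nat" where
  "max_degree V E = Max (degree E ` V)"

definition regular :: "'a set \<Rightarrow> 'a set set \<Rightarrow> bool" where
  "regular V E \<longleftrightarrow> (\<forall>u\<in>V. \<forall>v\<in>V. degree E u = degree E v)"

text \<open>The sum of \<open>f u v\<close> over all edges \<open>uv\<close>, each undirected edge being counted once.
  It is meaningful only for symmetric \<open>f\<close>, where the value on an edge does not depend on the order
  in which its ends are listed.\<close>

definition edge_sum :: "'a set set \<Rightarrow> ('a \<Rightarrow> 'a \<Rightarrow> real) \<Rightarrow> real" where
  "edge_sum E f = (\<Sum>e\<in>E. THE x. \<exists>u v. e = {u, v} \<and> x = f u v)"

lemma edge_value_eq: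
  fixes f :: "'a \<Rightarrow> 'a \<Rightarrow> real"
  assumes "\<And>u v. f u v = f v u"
  shows "(THE x. \<exists>u' v'. {u, v} = {u', v'} \<and> x = f u' v') = f u v"
proof (rule the_equality)
  show "\<exists>u' v'. {u, v} = {u', v'} \<and> f u v = f u' v'" by blast
next
  fix x
  assume "\<exists>u' v'. {u, v} = {u', v'} \<and> x = f u' v'"
  then show "x = f u v" using assms by (auto simp: doubleton_eq_iff)
qed

definition SDD :: "real \<Rightarrow> 'a set set \<Rightarrow> real" where
  "SDD \<alpha> E = edge_sum E (\<lambda>u v.
     real (degree E u) powr \<alpha> / real (degree E v) powr \<alpha> +
     real (degree E v) powr \<alpha> / real (degree E u) powr \<alpha>)"

definition zagreb1 :: "real \<Rightarrow> 'a set \<Rightarrow> 'a set set \<Rightarrow> real" where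
  "zagreb1 a V E = (\<Sum>u\<in>V. real (degree E u) powr a)"

definition zagreb2 :: "real \<Rightarrow> 'a set set \<Rightarrow> real" where
  "zagreb2 a E = edge_sum E (\<lambda>u v. (real (degree E u) * real (degree E v)) powr a)"

end

theory Submission
  imports Defs
begin

text \<open>
  Put \<open>w u = d\<^sub>u powr \<alpha>\<close>. All four quantities are sums over edges: the terms of \<open>SDD\<close> are
  \<open>((w u)\<^sup>2 + (w v)\<^sup>2) / (w u * w v)\<close>, those of \<open>M\<^sub>2\<close> are \<open>1 / (w u * w v)\<close>, and double
  counting of incidences gives \<open>M\<^sub>1\<close> the terms \<open>(w u)\<^sup>2 + (w v)\<^sup>2\<close>. Bounding the numerator or
  the denominator by the extreme values of \<open>w\<close> proves each inequality term by term; equality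
  forces both ends of every edge to have the extreme degree, and every vertex lies on an edge
  because \<open>\<delta> > 0\<close>.
\<close>

text \<open>Symmetry of \<open>f\<close> makes the definite description in \<open>edge_sum\<close>
  single-valued, so an edge can be evaluated through any listing of its ends. Agreement with
  \<open>g\<close> is asked for distinct ends only: no edge is a loop, and a sum or product over
  \<open>{u, u}\<close> would count the end once.\<close>

lemma edge_sum_eq_sum:
  assumes "simple_graph V E"
    and "\<And>u v. f u v = f v u"
    and "\<And>u v. u \<noteq> v \<Longrightarrow> f u v = g {u, v}"
  shows "edge_sum E f = sum g E"
  unfolding edge_sum_def
proof (rule sum.cong[OF refl])
  fix e
  assume "e \<in> E"
  then obtain u v where "u \<noteq> v" "e = {u, v}"
    using assms(1) unfolding simple_graph_def by blast
  then show "(THE x. \<exists>u v. e = {u, v} \<and> x = f u v) = g e"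
    using edge_value_eq[of f u v, OF assms(2)] assms(3) by simp
qed

lemma simple_graph_edge_subset:
  assumes "simple_graph V E" "e \<in> E"
  shows "e \<subseteq> V"
  using assms unfolding simple_graph_def by fastforce

lemma simple_graph_finite_edges:
  assumes "simple_graph V E"
  shows "finite E"
proof (rule finite_subset)
  show "E \<subseteq> Pow V" using simple_graph_edge_subset[OF assms] by blast
  show "finite (Pow V)" using assms by (simp add: simple_graph_def)
qed

text \<open>Double counting of incident pairs \<open>(u, e)\<close>: the left side adds
  \<open>h u\<close> once per edge at \<open>u\<close>, and swapping the summations groups the pairs
  by edge.\<close>

lemma sum_degree_weighted:
  fixes h :: "'a \<Rightarrow> real"
  assumes "simple_graph V E"
  shows "(\<Sum>u\<in>V. real (degree E u) * h u) = (\<Sum>e\<in>E. \<Sum>u\<in>e. h u)"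
proof -
  have fin: "finite V" "finite E"
    using assms simple_graph_finite_edges by (auto simp: simple_graph_def)
  have "(\<Sum>u\<in>V. real (degree E u) * h u) = (\<Sum>u\<in>V. \<Sum>e | e \<in> E \<and> u \<in> e. h u)"
    by (simp add: degree_def)
  also have "\<dots> = (\<Sum>e\<in>E. \<Sum>u | u \<in> V \<and> u \<in> e. h u)"
    using fin by (rule sum.swap_restrict)
  also have "\<dots> = (\<Sum>e\<in>E. \<Sum>u\<in>e. h u)"
    using simple_graph_edge_subset[OF assms]
    by (intro sum.cong refl) blast
  finally show ?thesis .
qed

text \<open>Over a finite set, one strict inequality between terms already makes the sums
  differ.\<close>

lemma sum_mono_eq_iff:
  fixes f g :: "'b \<Rightarrow> real"
  assumes "finite A" and "\<And>x. x \<in> A \<Longrightarrow> f x \<le> g x"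
  shows "sum f A = sum g A \<longleftrightarrow> (\<forall>x\<in>A. f x = g x)"
  using assms by (metis order_less_irrefl order_le_less sum.cong sum_strict_mono_ex1)

text \<open>Turns equality conditions on edges into regularity. As \<open>c\<close> is attained, a
  common degree can only be \<open>c\<close>; conversely, positive degrees let the degree of each
  vertex be read off on some edge.\<close>

lemma regular_iff_edge_ends:
  assumes "\<forall>u\<in>V. 0 < degree E u" "simple_graph V E" "c \<in> degree E ` V"
  shows "regular V E \<longleftrightarrow> (\<forall>e\<in>E. \<forall>u\<in>e. degree E u = c)"
proof
  assume "regular V E"
  then show "\<forall>e\<in>E. \<forall>u\<in>e. degree E u = c"
    using assms(3) simple_graph_edge_subset[OF assms(2)] unfolding regular_def by blast
next
  assume c: "\<forall>e\<in>E. \<forall>u\<in>e. degree E u = c"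
  have "degree E u = c" if "u \<in> V" for u
  proof -
    have "{e \<in> E. u \<in> e} \<noteq> {}"
      using assms(1) that unfolding degree_def by (metis card.empty less_irrefl)
    then show ?thesis using c by blast
  qed
  then show "regular V E" by (simp add: regular_def)
qed

text \<open>Common frame of the four bounds: with \<open>c\<close> an extreme degree, only the
  comparison on a single edge and its equality case remain.\<close>

lemma sum_edges_mono_regular:
  fixes f g :: "'a set \<Rightarrow> real"
  assumes "\<forall>u\<in>V. 0 < degree E u" "simple_graph V E" "c \<in> degree E ` V"
    and le: "\<And>e. e \<in> E \<Longrightarrow> f e \<le> g e \<and> (f e = g e \<longleftrightarrow> (\<forall>u\<in>e. degree E u = c))"
  shows "sum f E \<le> sum g E \<and> (sum f E = sum g E \<longleftrightarrow> regular V E)"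
proof
  show "sum f E \<le> sum g E" using le by (simp add: sum_mono)
  show "sum f E = sum g E \<longleftrightarrow> regular V E"
    using sum_mono_eq_iff[OF simple_graph_finite_edges[OF assms(2)], of f g] le
      regular_iff_edge_ends[OF assms(1-3)] by simp
qed

text \<open>Replacing one factor at a time squeezes \<open>a * y\<close> and \<open>x * a\<close>
  between \<open>a * a\<close> and \<open>x * y\<close>; when the outer values agree,
  \<open>a\<close> can be cancelled.\<close>

lemma mult_eq_square_iff_lower:
  fixes a x y :: real
  assumes "0 < a" "a \<le> x" "a \<le> y"
  shows "x * y = a\<^sup>2 \<longleftrightarrow> x = a \<and> y = a"
proof
  assume eq: "x * y = a\<^sup>2"
  have "a * a \<le> a * y" "a * y \<le> x * y" "x * a \<le> x * y"
    using assms by (auto intro: mult_left_mono mult_right_mono)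
  moreover have "a * a \<le> x * a" using assms by (auto intro: mult_right_mono)
  ultimately have "a * y = a * a" "x * a = a * a" using eq by (auto simp: power2_eq_square)
  then show "x = a \<and> y = a" using assms by simp
qed (simp add: power2_eq_square)

lemma mult_eq_square_iff_upper:
  fixes b x y :: real
  assumes "0 < x" "0 < y" "x \<le> b" "y \<le> b"
  shows "x * y = b\<^sup>2 \<longleftrightarrow> x = b \<and> y = b"
proof
  assume eq: "x * y = b\<^sup>2"
  have "b * y \<le> b * b" "x * y \<le> b * y" "x * y \<le> x * b" "x * b \<le> b * b"
    using assms by (auto intro: mult_left_mono mult_right_mono)
  then have "b * y = b * b" "x * b = b * b" using eq by (auto simp: power2_eq_square)
  then show "x = b \<and> y = b" using assms by auto
qed (simp add: power2_eq_square)

text \<open>Here \<open>x\<close> and \<open>y\<close> stand for \<open>w\<close> at the two ends of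
  an edge. Both sides share the positive denominator \<open>x * y\<close>, so only numerators are
  compared.\<close>

lemma square_sum_lower:
  fixes a x y :: real
  assumes "0 < a" "a \<le> x" "a \<le> y"
  shows "2 * a\<^sup>2 * inverse (x * y) \<le> (x\<^sup>2 + y\<^sup>2) / (x * y)
    \<and> (2 * a\<^sup>2 * inverse (x * y) = (x\<^sup>2 + y\<^sup>2) / (x * y) \<longleftrightarrow> x = a \<and> y = a)"
proof -
  have sq: "a\<^sup>2 \<le> x\<^sup>2" "a\<^sup>2 \<le> y\<^sup>2" using assms by (auto intro: power_mono)
  \<comment> \<open>Neither square is below \<open>a\<^sup>2\<close>, so an excess in one cannot be
    offset by the other.\<close>
  then have "2 * a\<^sup>2 = x\<^sup>2 + y\<^sup>2 \<longleftrightarrow> x\<^sup>2 = a\<^sup>2 \<and> y\<^sup>2 = a\<^sup>2" by auto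
  also have "\<dots> \<longleftrightarrow> x = a \<and> y = a" using assms by (simp add: power2_eq_iff_nonneg)
  finally show ?thesis using add_mono[OF sq] assms
    by (simp add: divide_inverse mult_right_mono)
qed

lemma square_sum_upper:
  fixes b x y :: real
  assumes "0 < x" "0 < y" "x \<le> b" "y \<le> b"
  shows "(x\<^sup>2 + y\<^sup>2) / (x * y) \<le> 2 * b\<^sup>2 * inverse (x * y)
    \<and> ((x\<^sup>2 + y\<^sup>2) / (x * y) = 2 * b\<^sup>2 * inverse (x * y) \<longleftrightarrow> x = b \<and> y = b)"
proof -
  have sq: "x\<^sup>2 \<le> b\<^sup>2" "y\<^sup>2 \<le> b\<^sup>2" using assms by (auto intro: power_mono)
  then have "x\<^sup>2 + y\<^sup>2 = 2 * b\<^sup>2 \<longleftrightarrow> x\<^sup>2 = b\<^sup>2 \<and> y\<^sup>2 = b\<^sup>2" by auto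
  also have "\<dots> \<longleftrightarrow> x = b \<and> y = b" using assms by (simp add: power2_eq_iff_nonneg)
  finally show ?thesis using add_mono[OF sq] assms
    by (simp add: divide_inverse mult_right_mono)
qed

text \<open>Now the numerators agree and the denominators \<open>b\<^sup>2\<close> and
  \<open>x * y\<close> are compared, so the lower bound comes from the upper bound \<open>b\<close>
  on \<open>x\<close> and \<open>y\<close>.\<close>

lemma square_sum_div_lower:
  fixes b x y :: real
  assumes "0 < x" "0 < y" "x \<le> b" "y \<le> b"
  shows "inverse (b\<^sup>2) * (x\<^sup>2 + y\<^sup>2) \<le> (x\<^sup>2 + y\<^sup>2) / (x * y)
    \<and> (inverse (b\<^sup>2) * (x\<^sup>2 + y\<^sup>2) = (x\<^sup>2 + y\<^sup>2) / (x * y) \<longleftrightarrow> x = b \<and> y = b)"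
proof -
  have pos: "0 < x\<^sup>2 + y\<^sup>2" using assms by (simp add: add_pos_pos)
  have "x * y \<le> b\<^sup>2" using assms by (simp add: power2_eq_square mult_mono)
  then have "inverse (b\<^sup>2) \<le> inverse (x * y)" using assms by (intro le_imp_inverse_le) auto
  moreover have "inverse (b\<^sup>2) = inverse (x * y) \<longleftrightarrow> x = b \<and> y = b"
    using mult_eq_square_iff_upper[OF assms] by (metis inverse_eq_iff_eq)
  \<comment> \<open>The positive sum of squares cancels; \<open>inverse (x * y)\<close> must stay
    unsplit to match the facts above.\<close>
  ultimately show ?thesis using pos assms
    by (simp add: divide_inverse mult.commute[of "x\<^sup>2 + y\<^sup>2"] mult_right_mono del: inverse_mult_distrib)
qed

lemma square_sum_div_upper:
  fixes a x y :: real
  assumes "0 < a" "a \<le> x" "a \<le> y"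
  shows "(x\<^sup>2 + y\<^sup>2) / (x * y) \<le> inverse (a\<^sup>2) * (x\<^sup>2 + y\<^sup>2)
    \<and> ((x\<^sup>2 + y\<^sup>2) / (x * y) = inverse (a\<^sup>2) * (x\<^sup>2 + y\<^sup>2) \<longleftrightarrow> x = a \<and> y = a)"
proof -
  have pos: "0 < x\<^sup>2 + y\<^sup>2" using assms by (simp add: add_pos_pos)
  have "a\<^sup>2 \<le> x * y" using assms by (simp add: power2_eq_square mult_mono)
  then have "inverse (x * y) \<le> inverse (a\<^sup>2)" using assms by (intro le_imp_inverse_le) auto
  moreover have "inverse (x * y) = inverse (a\<^sup>2) \<longleftrightarrow> x = a \<and> y = a"
    using mult_eq_square_iff_lower[OF assms] by (metis inverse_eq_iff_eq)
  ultimately show ?thesis using pos assms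
    by (simp add: divide_inverse mult.commute[of "x\<^sup>2 + y\<^sup>2"] mult_right_mono del: inverse_mult_distrib)
qed

theorem theorem2:
  fixes V :: "'a set" and E :: "'a set set" and \<alpha> :: real and \<delta> \<Delta> :: nat
  assumes "simple_graph V E"
    and "\<delta> = min_degree V E" and "\<Delta> = max_degree V E"
    and "\<delta> > 0"
    and "\<alpha> > 0"
  shows "2 * real \<delta> powr (2 * \<alpha>) * zagreb2 (- \<alpha>) E \<le> SDD \<alpha> E
    \<and> SDD \<alpha> E \<le> 2 * real \<Delta> powr (2 * \<alpha>) * zagreb2 (- \<alpha>) E
    \<and> real \<Delta> powr (- 2 * \<alpha>) * zagreb1 (2 * \<alpha> + 1) V E \<le> SDD \<alpha> E
    \<and> SDD \<alpha> E \<le> real \<delta> powr (- 2 * \<alpha>) * zagreb1 (2 * \<alpha> + 1) V E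
    \<and> (2 * real \<delta> powr (2 * \<alpha>) * zagreb2 (- \<alpha>) E = SDD \<alpha> E \<longleftrightarrow> regular V E)
    \<and> (SDD \<alpha> E = 2 * real \<Delta> powr (2 * \<alpha>) * zagreb2 (- \<alpha>) E \<longleftrightarrow> regular V E)
    \<and> (real \<Delta> powr (- 2 * \<alpha>) * zagreb1 (2 * \<alpha> + 1) V E = SDD \<alpha> E \<longleftrightarrow> regular V E)
    \<and> (SDD \<alpha> E = real \<delta> powr (- 2 * \<alpha>) * zagreb1 (2 * \<alpha> + 1) V E \<longleftrightarrow> regular V E)"
proof -
  define w where "w u = real (degree E u) powr \<alpha>" for u
  define S where "S e = (\<Sum>u\<in>e. (w u)\<^sup>2)" for e
  define P where "P e = (\<Prod>u\<in>e. w u)" for e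
  define a where "a = real \<delta> powr \<alpha>"
  define b where "b = real \<Delta> powr \<alpha>"
  have fin: "finite (degree E ` V)" "degree E ` V \<noteq> {}"
    using assms(1) by (auto simp: simple_graph_def)
  have attained: "\<delta> \<in> degree E ` V" "\<Delta> \<in> degree E ` V"
    using fin assms(2,3) by (auto simp: min_degree_def max_degree_def)
  have bounds: "\<delta> \<le> degree E u" "degree E u \<le> \<Delta>" if "u \<in> V" for u
    using fin assms(2,3) that by (auto simp: min_degree_def max_degree_def)
  have pos: "\<forall>u\<in>V. 0 < degree E u" using bounds(1) assms(4) by fastforce
  have \<Delta>: "0 < \<Delta>" using attained(2) pos by auto
  have a: "0 < a" using assms(4) by (simp add: a_def)
  \<comment> \<open>Strict monotonicity from \<alpha> > 0 gives injectivity, which translates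
    equality of \<open>w\<close> values back into equality of degrees.\<close>
  have powr_eq: "real m powr \<alpha> = real n powr \<alpha> \<longleftrightarrow> m = n" for m n :: nat
    using powr_less_mono2[OF assms(5), of "real m" "real n"]
      powr_less_mono2[OF assms(5), of "real n" "real m"]
    by (cases m n rule: linorder_cases) auto
  have w: "0 < w u" "a \<le> w u" "w u \<le> b"
      "w u = a \<longleftrightarrow> degree E u = \<delta>" "w u = b \<longleftrightarrow> degree E u = \<Delta>"
    if "u \<in> V" for u
    using that pos bounds[OF that] assms(4,5) \<Delta> powr_eq
    by (auto simp: w_def a_def b_def powr_mono2)
  have powr_double: "real n powr (2 * \<alpha>) = (real n powr \<alpha>)\<^sup>2"
      "real n powr (- 2 * \<alpha>) = inverse ((real n powr \<alpha>)\<^sup>2)" for n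
    by (simp_all add: power2_eq_square powr_add[symmetric] powr_minus[symmetric])
  have pair: "S {u, v} = (w u)\<^sup>2 + (w v)\<^sup>2" "P {u, v} = w u * w v" if "u \<noteq> v" for u v
    using that by (simp_all add: S_def P_def)
  have edge: "\<exists>u v. e = {u, v} \<and> u \<in> V \<and> v \<in> V \<and>
      S e = (w u)\<^sup>2 + (w v)\<^sup>2 \<and> P e = w u * w v" if "e \<in> E" for e
    using assms(1) that pair unfolding simple_graph_def by metis

  \<comment> \<open>Here \<open>u\<close> and \<open>v\<close> are arbitrary and may have degree 0;
    in that case both sides are 0 because division by zero yields 0.\<close>
  have "w u / w v + w v / w u = S {u, v} / P {u, v}" if "u \<noteq> v" for u v
    using pair[OF that] by (cases "w u = 0 \<or> w v = 0") (auto simp: field_simps power2_eq_square)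
  then have SDD: "SDD \<alpha> E = (\<Sum>e\<in>E. S e / P e)"
    unfolding SDD_def by (intro edge_sum_eq_sum[OF assms(1)]) (auto simp: w_def)
  have "zagreb2 (- \<alpha>) E = (\<Sum>e\<in>E. inverse (P e))"
    unfolding zagreb2_def
    by (intro edge_sum_eq_sum[OF assms(1)])
      (auto simp: pair w_def powr_minus powr_mult mult.commute)
  then have M2: "c * zagreb2 (- \<alpha>) E = (\<Sum>e\<in>E. c * inverse (P e))" for c
    by (simp add: sum_distrib_left)
  \<comment> \<open>The extra 1 in the exponent supplies the factor \<open>degree E u\<close> that
    double counting requires.\<close>
  have "zagreb1 (2 * \<alpha> + 1) V E = (\<Sum>u\<in>V. real (degree E u) * (w u)\<^sup>2)"
    unfolding zagreb1_def w_def
    by (intro sum.cong refl) (simp add: powr_add powr_double(1))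
  also have "\<dots> = (\<Sum>e\<in>E. S e)"
    unfolding S_def by (rule sum_degree_weighted[OF assms(1)])
  finally have M1: "c * zagreb1 (2 * \<alpha> + 1) V E = (\<Sum>e\<in>E. c * S e)" for c
    by (simp add: sum_distrib_left)

  note termwise = sum_edges_mono_regular[OF pos assms(1)]
  have "(\<Sum>e\<in>E. 2 * a\<^sup>2 * inverse (P e)) \<le> (\<Sum>e\<in>E. S e / P e) \<and>
      ((\<Sum>e\<in>E. 2 * a\<^sup>2 * inverse (P e)) = (\<Sum>e\<in>E. S e / P e) \<longleftrightarrow> regular V E)"
  proof (rule termwise[OF attained(1)])
    fix e assume "e \<in> E"
    then obtain u v where e: "e = {u, v}" "u \<in> V" "v \<in> V"
      "S e = (w u)\<^sup>2 + (w v)\<^sup>2" "P e = w u * w v" using edge by blast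
    show "2 * a\<^sup>2 * inverse (P e) \<le> S e / P e \<and>
      (2 * a\<^sup>2 * inverse (P e) = S e / P e \<longleftrightarrow> (\<forall>u\<in>e. degree E u = \<delta>))"
      unfolding e(4,5) using square_sum_lower[OF a w(2)[OF e(2)] w(2)[OF e(3)]] w(4) e by simp
  qed
  moreover have "(\<Sum>e\<in>E. S e / P e) \<le> (\<Sum>e\<in>E. 2 * b\<^sup>2 * inverse (P e)) \<and>
      ((\<Sum>e\<in>E. S e / P e) = (\<Sum>e\<in>E. 2 * b\<^sup>2 * inverse (P e)) \<longleftrightarrow> regular V E)"
  proof (rule termwise[OF attained(2)])
    fix e assume "e \<in> E"
    then obtain u v where e: "e = {u, v}" "u \<in> V" "v \<in> V"
      "S e = (w u)\<^sup>2 + (w v)\<^sup>2" "P e = w u * w v" using edge by blast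
    show "S e / P e \<le> 2 * b\<^sup>2 * inverse (P e) \<and>
      (S e / P e = 2 * b\<^sup>2 * inverse (P e) \<longleftrightarrow> (\<forall>u\<in>e. degree E u = \<Delta>))"
      unfolding e(4,5)
      using square_sum_upper[OF w(1)[OF e(2)] w(1)[OF e(3)] w(3)[OF e(2)] w(3)[OF e(3)]] w(5) e
      by simp
  qed
  moreover have "(\<Sum>e\<in>E. inverse (b\<^sup>2) * S e) \<le> (\<Sum>e\<in>E. S e / P e) \<and>
      ((\<Sum>e\<in>E. inverse (b\<^sup>2) * S e) = (\<Sum>e\<in>E. S e / P e) \<longleftrightarrow> regular V E)"
  proof (rule termwise[OF attained(2)])
    fix e assume "e \<in> E"
    then obtain u v where e: "e = {u, v}" "u \<in> V" "v \<in> V"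
      "S e = (w u)\<^sup>2 + (w v)\<^sup>2" "P e = w u * w v" using edge by blast
    show "inverse (b\<^sup>2) * S e \<le> S e / P e \<and>
      (inverse (b\<^sup>2) * S e = S e / P e \<longleftrightarrow> (\<forall>u\<in>e. degree E u = \<Delta>))"
      unfolding e(4,5)
      using square_sum_div_lower[OF w(1)[OF e(2)] w(1)[OF e(3)] w(3)[OF e(2)] w(3)[OF e(3)]] w(5) e
      by simp
  qed
  moreover have "(\<Sum>e\<in>E. S e / P e) \<le> (\<Sum>e\<in>E. inverse (a\<^sup>2) * S e) \<and>
      ((\<Sum>e\<in>E. S e / P e) = (\<Sum>e\<in>E. inverse (a\<^sup>2) * S e) \<longleftrightarrow> regular V E)"
  proof (rule termwise[OF attained(1)])
    fix e assume "e \<in> E"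
    then obtain u v where e: "e = {u, v}" "u \<in> V" "v \<in> V"
      "S e = (w u)\<^sup>2 + (w v)\<^sup>2" "P e = w u * w v" using edge by blast
    show "S e / P e \<le> inverse (a\<^sup>2) * S e \<and>
      (S e / P e = inverse (a\<^sup>2) * S e \<longleftrightarrow> (\<forall>u\<in>e. degree E u = \<delta>))"
      unfolding e(4,5)
      using square_sum_div_upper[OF a w(2)[OF e(2)] w(2)[OF e(3)]] w(4) e by simp
  qed
  ultimately show ?thesis
    unfolding SDD M1 M2 powr_double a_def[symmetric] b_def[symmetric] by blast
qed

end
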